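(* Let $0<p<1$ and $\rho=\log(1+2p)/\log(1+p)$. For every integer $j\ge1$, $p_k=\Theta\bigl(k^{-1-\rho}\bigr)$ as $k\to\infty$; that is, there are constants $0<c\le C<\infty$ (depending only on $p$ and $j$) with $c\,k^{-1-\rho}\le p_k\le C\,k^{-1-\rho}$ for all large $k$. In particular, the exponent $1+\rho$ does not depend on $j$, and the limiting degree distributions of the homogeneous evolving network (the case $j=2$) and of the treelike fast-growth model (the case $j=1$) satisfy $p_k=\Theta(k^{-1-\rho})$.
   Context: The sequence $\{p_k\}$: for an integer $j\ge1$, the functional equation $$(1+2p)\,g(x)=2p\,x^{j}+g\bigl(x-px+px^{2}\bigr),\qquad 0\le x\le1,$$ has a unique solution $g$ that is a probability generating function (a recalled fact); write $g(x)=\sum_{k\ge j}p_kx^k$. Here $p_k$ depends on $p$ and $j$. Equivalently, $p_k=\sum_{n\ge0}\frac{2p}{1+2p}(1+2p)^{-n}P(D^*_n=k)$ for $k\ge j$, where $(D^*_n)$ is the Galton-Watson process with $D^*_0=j$ whose offspring law puts mass $1-p$ on $1$ and mass $p$ on $2$. Network models: the homogeneous evolving network starts at time $0$ from a single edge; at each step, independently with probability $p$, every edge of the current graph recruits a new node joined to both of its endpoints. Its empirical degree distribution converges almost surely to the law $\{p_k\}$ given by the equation above with $j=2$. The treelike fast-growth preferential-attachment model (in which a tracked vertex begins with a single edge) has almost sure limiting degree distribution given by the law $\{p_k\}$ with $j=1$. These identifications are known and serve to specify which laws $\{p_k\}$ are meant. *)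

theory Defs
  imports "HOL-Probability.Probability" "HOL-Library.Landau_Symbols"
begin

definition prob_gen_fun :: "nat pmf \<Rightarrow> real \<Rightarrow> real" where
  "prob_gen_fun q x = (\<Sum>k. pmf q k * x ^ k)"

definition solves_degree_equation :: "real \<Rightarrow> nat \<Rightarrow> (real \<Rightarrow> real) \<Rightarrow> bool" where
  "solves_degree_equation p j g \<longleftrightarrow>
     (\<forall>x\<in>{0..1}. (1 + 2 * p) * g x = 2 * p * x ^ j + g (x - p * x + p * x\<^sup>2))"

text \<open>
  For \<open>0 < p < 1\<close> the law below is well defined, by lemma \<open>degree_law_ex1\<close>.
\<close>

definition degree_law :: "real \<Rightarrow> nat \<Rightarrow> nat pmf" where
  "degree_law p j = (THE q. solves_degree_equation p j (prob_gen_fun q))"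

text \<open>
  The almost sure limits of the empirical degree distributions of the two network models are
  known to be the laws with \<open>j = 2\<close> (homogeneous evolving network) and \<open>j = 1\<close> (treelike
  fast-growth preferential attachment); here these identifications are taken as definitions
  of the limits.
\<close>

definition homogeneous_network_degree_law :: "real \<Rightarrow> nat pmf" where
  "homogeneous_network_degree_law p = degree_law p 2"

definition treelike_network_degree_law :: "real \<Rightarrow> nat pmf" where
  "treelike_network_degree_law p = degree_law p 1"


text \<open>Existence is shown by the law of a Galton-Watson process at an independent geometric time.\<close>

definition offspring_law :: "real \<Rightarrow> nat pmf" where
  "offspring_law p = map_pmf (\<lambda>b. if b then 2 else 1) (bernoulli_pmf p)"

primrec galton_watson :: "real \<Rightarrow> nat \<Rightarrow> nat \<Rightarrow> nat pmf" where
  "galton_watson p j 0 = return_pmf j"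
| "galton_watson p j (Suc n) =
     bind_pmf (galton_watson p j n) (\<lambda>k. map_pmf sum_list (replicate_pmf k (offspring_law p)))"

definition galton_watson_mixture :: "real \<Rightarrow> nat \<Rightarrow> nat pmf" where
  "galton_watson_mixture p j = bind_pmf (geometric_pmf (2 * p / (1 + 2 * p))) (galton_watson p j)"

lemma sums_pmf_nat: "pmf (q :: nat pmf) sums 1"
proof -
  have "(\<Sum>k. ennreal (pmf q k)) = (\<integral>\<^sup>+k. ennreal (pmf q k) \<partial>count_space UNIV)"
    by (simp add: nn_integral_count_space_nat)
  also have "\<dots> = 1"
    by (simp add: nn_integral_pmf_eq_1)
  finally have eq: "(\<Sum>k. ennreal (pmf q k)) = 1" .
  then have "(\<lambda>k. ennreal (pmf q k)) sums ennreal 1"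
    by (metis ennreal_1 summableI summable_sums)
  then show ?thesis
    by (subst (asm) sums_ennreal) auto
qed

lemma summable_prob_gen_fun:
  assumes "0 \<le> x" "x \<le> (1::real)"
  shows "summable (\<lambda>k. pmf q k * x ^ k)"
proof (rule summable_comparison_test)
  show "summable (pmf q)"
    using sums_pmf_nat by (rule sums_summable)
  show "\<exists>N. \<forall>n\<ge>N. norm (pmf q n * x ^ n) \<le> pmf q n"
    using assms by (auto simp: abs_mult power_le_one mult_left_le)
qed

lemma prob_gen_fun_bounds:
  assumes "0 \<le> x" "x \<le> (1::real)"
  shows "0 \<le> prob_gen_fun q x" "prob_gen_fun q x \<le> 1"
proof -
  show "0 \<le> prob_gen_fun q x"
    unfolding prob_gen_fun_def
    by (intro suminf_nonneg summable_prob_gen_fun assms) (use assms in auto)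
  have "prob_gen_fun q x \<le> (\<Sum>k. pmf q k)"
    unfolding prob_gen_fun_def
    by (intro suminf_le summable_prob_gen_fun assms sums_summable[OF sums_pmf_nat])
       (use assms in \<open>auto simp: power_le_one mult_left_le\<close>)
  then show "prob_gen_fun q x \<le> 1"
    using sums_unique[OF sums_pmf_nat[of q]] by simp
qed

lemma nn_integral_power_pmf:
  assumes "0 \<le> x" "x \<le> (1::real)"
  shows "(\<integral>\<^sup>+k. ennreal (x ^ k) \<partial>measure_pmf q) = ennreal (prob_gen_fun q x)"
proof -
  have "(\<integral>\<^sup>+k. ennreal (x ^ k) \<partial>measure_pmf q) = (\<Sum>k. ennreal (pmf q k * x ^ k))"
    by (simp add: nn_integral_measure_pmf nn_integral_count_space_nat ennreal_mult' assms)
  also have "\<dots> = ennreal (prob_gen_fun q x)"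
    unfolding prob_gen_fun_def using assms
    by (intro suminf_ennreal2 summable_prob_gen_fun) auto
  finally show ?thesis .
qed

lemma power_series_zero_coeffs:
  fixes h :: "nat \<Rightarrow> real"
  assumes h: "summable h"
    and zero: "\<And>x. 0 < x \<Longrightarrow> x < 1 \<Longrightarrow> (\<Sum>k. h k * x ^ k) = 0"
  shows "h n = 0"
proof (induction n rule: less_induct)
  case (less n)
  let ?F = "\<lambda>x. \<Sum>k. h (k + n) * x ^ k"
  have F0: "?F x = 0" if x: "0 < x" "x < 1" for x
  proof -
    have sm: "summable (\<lambda>k. h k * x ^ k)"
      using powser_inside[of h 1 x] h x by simp
    have "(\<Sum>k. h k * x ^ k) = (\<Sum>k. h (k + n) * x ^ (k + n)) + (\<Sum>k<n. h k * x ^ k)"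
      by (rule suminf_split_initial_segment[OF sm])
    also have "(\<Sum>k<n. h k * x ^ k) = 0"
      using less by simp
    also have "(\<Sum>k. h (k + n) * x ^ (k + n)) = (\<Sum>k. x ^ n * (h (k + n) * x ^ k))"
      by (simp add: power_add mult_ac)
    also have "\<dots> = x ^ n * ?F x"
    proof (rule suminf_mult)
      have "summable (\<lambda>k. h (k + n))"
        using h by (simp add: summable_iff_shift)
      then show "summable (\<lambda>k. h (k + n) * x ^ k)"
        using powser_inside[of "\<lambda>k. h (k + n)" 1 x] x by simp
    qed
    finally show ?thesis
      using zero[OF x] x by simp
  qed
  have "isCont ?F 0"
    by (rule isCont_powser[where K = 1]) (use h in \<open>simp_all add: summable_iff_shift\<close>)
  then have "(?F \<longlongrightarrow> ?F 0) (at_right 0)"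
    by (simp add: isCont_def filterlim_at_split)
  moreover have "eventually (\<lambda>x. 0 = ?F x) (at_right 0)"
    using eventually_at_right_real[of 0 1, simplified]
    by (rule eventually_mono) (use F0 in auto)
  ultimately have "?F 0 = 0"
    using tendsto_cong[of "\<lambda>x. 0" ?F "at_right 0" "?F 0"]
      tendsto_unique[OF trivial_limit_at_right_real, of "\<lambda>x. 0" 0 "?F 0" 0]
    by (simp add: tendsto_const_iff)
  then show ?case
    by simp
qed

lemma prob_gen_fun_inject:
  assumes "\<And>x. 0 \<le> x \<Longrightarrow> x \<le> 1 \<Longrightarrow> prob_gen_fun q x = prob_gen_fun r x"
  shows "q = r"
proof (rule pmf_eqI)
  fix n
  have "pmf q n - pmf r n = 0"
  proof (rule power_series_zero_coeffs[where h = "\<lambda>k. pmf q k - pmf r k"])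
    show "summable (\<lambda>k. pmf q k - pmf r k)"
      by (intro summable_diff sums_summable[OF sums_pmf_nat])
    fix x :: real assume x: "0 < x" "x < 1"
    have "(\<Sum>k. (pmf q k - pmf r k) * x ^ k) = prob_gen_fun q x - prob_gen_fun r x"
      unfolding prob_gen_fun_def left_diff_distrib using x
      by (intro suminf_diff[symmetric] summable_prob_gen_fun) auto
    then show "(\<Sum>k. (pmf q k - pmf r k) * x ^ k) = 0"
      using assms x by simp
  qed
  then show "pmf q n = pmf r n" by simp
qed

lemma offspring_gen_fun_unit:
  assumes "0 < p" "p < 1" "0 \<le> x" "x \<le> (1::real)"
  shows "0 \<le> x - p * x + p * x\<^sup>2" "x - p * x + p * x\<^sup>2 \<le> 1"
proof -
  have "x - p * x + p * x\<^sup>2 = x * ((1 - p) + p * x)"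
    by (simp add: algebra_simps power2_eq_square)
  moreover have "0 \<le> (1 - p) + p * x" "(1 - p) + p * x \<le> 1"
    using assms by (auto simp: mult_left_le)
  ultimately show "0 \<le> x - p * x + p * x\<^sup>2" "x - p * x + p * x\<^sup>2 \<le> 1"
    using assms by (auto simp: mult_le_one)
qed

lemma degree_equation_unique:
  assumes p: "0 < p" "p < 1"
    and q: "solves_degree_equation p j (prob_gen_fun q)"
    and r: "solves_degree_equation p j (prob_gen_fun r)"
  shows "q = r"
proof (rule prob_gen_fun_inject)
  let ?h = "\<lambda>x. prob_gen_fun q x - prob_gen_fun r x"
  let ?f = "\<lambda>x. x - p * x + p * x\<^sup>2"
  have bound: "\<bar>?h x\<bar> \<le> (1 / (1 + 2 * p)) ^ n" if "0 \<le> x" "x \<le> 1" for x n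
    using that
  proof (induction n arbitrary: x)
    case 0
    then show ?case
      using prob_gen_fun_bounds[of x q] prob_gen_fun_bounds[of x r] by auto
  next
    case (Suc n)
    have "(1 + 2 * p) * ?h x = ?h (?f x)"
      using q r Suc.prems by (auto simp: solves_degree_equation_def algebra_simps)
    then have "?h x = ?h (?f x) / (1 + 2 * p)"
      using p by (simp add: field_simps)
    then have "\<bar>?h x\<bar> = \<bar>?h (?f x)\<bar> / (1 + 2 * p)"
      using p by (simp add: abs_divide)
    also have "\<dots> \<le> (1 / (1 + 2 * p)) ^ n / (1 + 2 * p)"
      using p offspring_gen_fun_unit[OF p Suc.prems] by (intro divide_right_mono Suc.IH) auto
    finally show ?case by simp
  qed
  fix x :: real assume x: "0 \<le> x" "x \<le> 1"
  have "(\<lambda>n. (1 / (1 + 2 * p)) ^ n) \<longlonglongrightarrow> 0"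
    using p by (intro LIMSEQ_power_zero) (auto simp: abs_divide)
  then have "\<bar>?h x\<bar> \<le> 0"
    using bound[OF x] by (intro LIMSEQ_le_const) auto
  then show "prob_gen_fun q x = prob_gen_fun r x" by simp
qed

lemma prob_gen_fun_mixture_equation:
  assumes p: "0 < p" "p < 1"
  shows "solves_degree_equation p j (prob_gen_fun (galton_watson_mixture p j))"
  unfolding solves_degree_equation_def
proof
  fix x :: real assume "x \<in> {0..1}"
  then have x: "0 \<le> x" "x \<le> 1" by auto
  define f where "f = x - p * x + p * x\<^sup>2"
  define a where "a = 2 * p / (1 + 2 * p)"
  define M where "M = galton_watson_mixture p j"
  define step where "step = (\<lambda>k. map_pmf sum_list (replicate_pmf k (offspring_law p)))"
  have a: "0 < a" "a < 1" "1 - a = 1 / (1 + 2 * p)"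
    using p by (auto simp: a_def field_simps)
  have f: "0 \<le> f" "f \<le> 1"
    unfolding f_def by (rule offspring_gen_fun_unit[OF p x])+
  have step: "(\<integral>\<^sup>+m. ennreal (x ^ m) \<partial>measure_pmf (step k)) = ennreal (f ^ k)" for k
  proof (induction k)
    case 0
    show ?case by (simp add: step_def)
  next
    case (Suc k)
    have step_Suc: "step (Suc k) =
        bind_pmf (offspring_law p) (\<lambda>y. map_pmf ((+) y) (step k))"
      by (simp add: step_def map_pmf_def bind_assoc_pmf bind_return_pmf)
    have "(\<integral>\<^sup>+m. ennreal (x ^ m) \<partial>measure_pmf (step (Suc k))) =
        (\<integral>\<^sup>+y. ennreal (x ^ y) * ennreal (f ^ k) \<partial>measure_pmf (offspring_law p))"
      using x by (simp add: step_Suc power_add ennreal_mult nn_integral_cmult Suc.IH)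
    also have "\<dots> = ennreal f * ennreal (f ^ k)"
    proof -
      have "ennreal (x\<^sup>2) * ennreal p + ennreal x * ennreal (1 - p) = ennreal f"
        using p x
        by (simp add: f_def ennreal_mult[symmetric] ennreal_plus[symmetric] algebra_simps
            mult_left_le_one_le del: ennreal_plus)
      then show ?thesis
        using p by (simp add: offspring_law_def nn_integral_multc)
    qed
    finally show ?case
      using f by (simp add: ennreal_mult)
  qed
  have M_eq: "M = bind_pmf (bernoulli_pmf a) (\<lambda>b. if b then return_pmf j else bind_pmf M step)"
  proof -
    have comm: "bind_pmf (geometric_pmf a) (\<lambda>n. bind_pmf (galton_watson p j n) step) =
        bind_pmf M step"
      by (simp add: M_def galton_watson_mixture_def a_def bind_assoc_pmf)
    have "M = bind_pmf (bernoulli_pmf a)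
        (\<lambda>b. bind_pmf (if b then return_pmf 0 else map_pmf Suc (geometric_pmf a))
          (galton_watson p j))"
      unfolding M_def galton_watson_mixture_def a_def[symmetric]
      by (subst geometric_bind_pmf_unfold) (use a in \<open>auto simp: bind_assoc_pmf\<close>)
    also have "\<dots> = bind_pmf (bernoulli_pmf a)
        (\<lambda>b. if b then return_pmf j else bind_pmf M step)"
      using comm
      by (intro bind_pmf_cong) (auto simp: bind_return_pmf bind_map_pmf step_def[symmetric])
    finally show ?thesis .
  qed
  have "ennreal (prob_gen_fun M x) = (\<integral>\<^sup>+k. ennreal (x ^ k) \<partial>measure_pmf M)"
    by (simp add: nn_integral_power_pmf x)
  also have "\<dots> = ennreal (x ^ j) * ennreal a + ennreal (prob_gen_fun M f) * ennreal (1 - a)"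
    by (subst M_eq) (use a f in \<open>simp add: step nn_integral_power_pmf\<close>)
  also have "\<dots> = ennreal (x ^ j * a + prob_gen_fun M f * (1 - a))"
    using a(1,2) x f prob_gen_fun_bounds[of f M]
    by (simp add: ennreal_mult[symmetric] ennreal_plus[symmetric] del: ennreal_plus)
  finally have M_x: "prob_gen_fun M x = x ^ j * a + prob_gen_fun M f * (1 - a)"
    using a(1,2) x f prob_gen_fun_bounds[of f M] prob_gen_fun_bounds[of x M]
    by (simp del: ennreal_plus)
  have "(1 + 2 * p) * prob_gen_fun M x =
      ((1 + 2 * p) * a) * x ^ j + ((1 + 2 * p) * (1 - a)) * prob_gen_fun M f"
    unfolding M_x by (simp add: algebra_simps)
  also have "(1 + 2 * p) * a = 2 * p"
    using p by (simp add: a_def)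
  also have "(1 + 2 * p) * (1 - a) = 1"
    using p a(3) by simp
  finally show "(1 + 2 * p) * prob_gen_fun (galton_watson_mixture p j) x =
      2 * p * x ^ j + prob_gen_fun (galton_watson_mixture p j) (x - p * x + p * x\<^sup>2)"
    by (simp add: M_def f_def)
qed

lemma degree_law_ex1:
  assumes "0 < p" "p < 1"
  shows "\<exists>!q. solves_degree_equation p j (prob_gen_fun q)"
  using degree_equation_unique[OF assms] prob_gen_fun_mixture_equation[OF assms] by blast

lemma degree_law_eq_mixture:
  assumes "0 < p" "p < 1"
  shows "degree_law p j = galton_watson_mixture p j"
  unfolding degree_law_def
  using degree_equation_unique[OF assms] prob_gen_fun_mixture_equation[OF assms] by blast

end

theory Submission
  imports Defs "HOL-Real_Asymp.Real_Asymp"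
begin

text \<open>
  With \<open>b m k\<close> the probability that \<open>m\<close> individuals have \<open>k\<close> children in total, the functional
  equation reads \<open>(1 + 2p) p\<^sub>k = 2p [k = j] + (\<Sum>m\<le>k. b m k p\<^sub>m)\<close>. The sums \<open>\<Sum>m. b m k\<close> are renewal
  probabilities tending to \<open>1/(1 + p)\<close>, and under the weights \<open>b _ k\<close> the index \<open>m\<close> is concentrated
  within \<open>O(sqrt k)\<close> of \<open>k/(1 + p)\<close>. Hence the operator \<open>w \<mapsto> (\<Sum>m. b m k w\<^sub>m)\<close> multiplies \<open>k powr - a\<close> by
  \<open>(1 + p) powr (a - 1)\<close> up to a lower order term, and this factor is \<open>1 + 2p\<close> exactly when
  \<open>a = 1 + \<rho>\<close>. Slightly corrected powers are strict sub- and supersolutions, with which the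
  sequence \<open>p\<^sub>k\<close> is compared.
\<close>

section \<open>Total offspring of a generation and the recursion for the law\<close>

definition offspring_sum :: "real \<Rightarrow> nat \<Rightarrow> nat pmf" where
  "offspring_sum p m = map_pmf sum_list (replicate_pmf m (offspring_law p))"

lemma offspring_sum_0: "offspring_sum p 0 = return_pmf 0"
  by (simp add: offspring_sum_def)

lemma offspring_sum_Suc:
  "offspring_sum p (Suc m) = bind_pmf (offspring_law p) (\<lambda>y. map_pmf ((+) y) (offspring_sum p m))"
  by (simp add: offspring_sum_def map_pmf_def bind_assoc_pmf bind_return_pmf)

text \<open>A geometric time is either zero or distributed as one plus a geometric time. In the
  second case the extra generation is applied last.\<close>

lemma galton_watson_mixture_unfold:
  assumes "0 < p" "p < 1"
  shows "galton_watson_mixture p j = bind_pmf (bernoulli_pmf (2 * p / (1 + 2 * p)))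
    (\<lambda>b. if b then return_pmf j else bind_pmf (galton_watson_mixture p j) (offspring_sum p))"
proof -
  define a where "a = 2 * p / (1 + 2 * p)"
  have a: "0 < a" "a < 1"
    using assms by (auto simp: a_def field_simps)
  have mixture: "bind_pmf (geometric_pmf a) (\<lambda>n. bind_pmf (galton_watson p j n) (offspring_sum p)) =
      bind_pmf (galton_watson_mixture p j) (offspring_sum p)"
    by (simp add: galton_watson_mixture_def a_def bind_assoc_pmf)
  have "galton_watson_mixture p j = bind_pmf (bernoulli_pmf a)
      (\<lambda>b. bind_pmf (if b then return_pmf 0 else map_pmf Suc (geometric_pmf a)) (galton_watson p j))"
    unfolding galton_watson_mixture_def a_def[symmetric]
    by (subst geometric_bind_pmf_unfold) (use a in \<open>auto simp: bind_assoc_pmf\<close>)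
  also have "\<dots> = bind_pmf (bernoulli_pmf a)
      (\<lambda>b. if b then return_pmf j else bind_pmf (galton_watson_mixture p j) (offspring_sum p))"
    using mixture
    by (intro bind_pmf_cong)
       (auto simp: bind_return_pmf bind_map_pmf offspring_sum_def[abs_def])
  finally show ?thesis
    unfolding a_def .
qed

context
  fixes p :: real
  assumes p: "0 < p" "p < 1"
begin

text \<open>Condition on the first individual. The guards exclude the spurious terms that truncated
  subtraction would create.\<close>

lemma pmf_offspring_sum_Suc:
  "pmf (offspring_sum p (Suc m)) k =
    (1 - p) * (if 1 \<le> k then pmf (offspring_sum p m) (k - 1) else 0) +
    p * (if 2 \<le> k then pmf (offspring_sum p m) (k - 2) else 0)"
proof -
  have shift: "pmf (map_pmf ((+) y) M) k = (if y \<le> k then pmf M (k - y) else 0)" for y and M :: "nat pmf"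
  proof (cases "y \<le> k")
    case True
    then have "pmf (map_pmf ((+) y) M) (y + (k - y)) = pmf M (k - y)"
      by (intro pmf_map_inj') (auto simp: inj_on_def)
    with True show ?thesis by simp
  next
    case False
    then show ?thesis by (auto simp: pmf_eq_0_set_pmf)
  qed
  show ?thesis
    using p by (simp add: offspring_sum_Suc offspring_law_def bind_map_pmf pmf_bind shift)
qed

lemma pmf_offspring_sum_0: "pmf (offspring_sum p 0) k = (if k = 0 then 1 else 0)"
  by (simp add: offspring_sum_0 indicator_def)

lemma pmf_offspring_sum_Suc_1: "pmf (offspring_sum p (Suc m)) (Suc 0) = (1 - p) * pmf (offspring_sum p m) 0"
  and pmf_offspring_sum_Suc_Suc: "pmf (offspring_sum p (Suc m)) (Suc (Suc k)) =
    (1 - p) * pmf (offspring_sum p m) (Suc k) + p * pmf (offspring_sum p m) k"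
  by (simp_all add: pmf_offspring_sum_Suc)

text \<open>Every individual has one or two children. Sums over \<open>m\<close> are therefore
  finite and live on \<open>k \<le> 2 * m\<close>, \<open>m \<le> k\<close>.\<close>

lemma pmf_offspring_sum_eq_0: "k < m \<or> 2 * m < k \<Longrightarrow> pmf (offspring_sum p m) k = 0"
proof (induction m arbitrary: k)
  case (Suc m)
  have "1 \<le> k \<Longrightarrow> pmf (offspring_sum p m) (k - 1) = 0" "2 \<le> k \<Longrightarrow> pmf (offspring_sum p m) (k - 2) = 0"
    using Suc.prems by (auto intro!: Suc.IH)
  then show ?case
    by (simp add: pmf_offspring_sum_Suc split del: if_split cong: if_cong)
qed (auto simp: pmf_offspring_sum_0)

lemma pmf_offspring_sum_diag_pos: "0 < pmf (offspring_sum p m) m"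
  using p by (induction m) (simp_all add: pmf_offspring_sum_0 pmf_offspring_sum_Suc add_pos_nonneg)

text \<open>It suffices that the first individual has two children and the others one. This carries
  positivity of the law from \<open>m\<close> to \<open>Suc m\<close>.\<close>

lemma pmf_offspring_sum_superdiag_pos: "0 < m \<Longrightarrow> 0 < pmf (offspring_sum p m) (Suc m)"
proof (cases m)
  case (Suc n)
  then show ?thesis
    using p pmf_offspring_sum_diag_pos[of n] by (simp add: pmf_offspring_sum_Suc_Suc add_nonneg_pos)
qed simp

lemma pmf_galton_watson_mixture:
  "(1 + 2 * p) * pmf (galton_watson_mixture p j) k = (if k = j then 2 * p else 0) +
    (\<Sum>m\<le>k. pmf (offspring_sum p m) k * pmf (galton_watson_mixture p j) m)"
proof -
  let ?M = "galton_watson_mixture p j"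
  define a where "a = 2 * p / (1 + 2 * p)"
  have a: "0 \<le> a" "a \<le> 1" "(1 + 2 * p) * a = 2 * p" "(1 + 2 * p) * (1 - a) = 1"
    using p by (auto simp: a_def field_simps)
  have bind: "pmf (bind_pmf ?M (offspring_sum p)) k =
      (\<Sum>m\<le>k. pmf (offspring_sum p m) k * pmf ?M m)"
    unfolding pmf_bind
    by (rule integral_measure_pmf_real) (auto simp: not_le intro: ccontr pmf_offspring_sum_eq_0)
  have "pmf ?M k = a * (if k = j then 1 else 0) +
      (1 - a) * pmf (bind_pmf ?M (offspring_sum p)) k"
    by (subst galton_watson_mixture_unfold[OF p])
       (use a in \<open>simp add: pmf_bind[of "bernoulli_pmf _"] a_def[symmetric] indicator_def\<close>)
  then have "(1 + 2 * p) * pmf ?M k = ((1 + 2 * p) * a) * (if k = j then 1 else 0) +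
      ((1 + 2 * p) * (1 - a)) * pmf (bind_pmf ?M (offspring_sum p)) k"
    by (simp only: distrib_left mult.assoc)
  then show ?thesis
    unfolding a bind by simp
qed

lemma pmf_galton_watson_mixture_pos:
  assumes "1 \<le> j" "j \<le> k"
  shows "0 < pmf (galton_watson_mixture p j) k"
  using assms(2)
proof (induction k rule: dec_induct)
  case base
  have "0 < (1 + 2 * p) * pmf (galton_watson_mixture p j) j"
    unfolding pmf_galton_watson_mixture using p by (auto intro!: add_pos_nonneg sum_nonneg)
  then show ?case using p by (simp add: zero_less_mult_iff)
next
  case (step k)
  have "0 < pmf (offspring_sum p k) (Suc k) * pmf (galton_watson_mixture p j) k"
    using step assms pmf_offspring_sum_superdiag_pos[of k] by auto
  also have "\<dots> \<le> (\<Sum>m\<le>Suc k. pmf (offspring_sum p m) (Suc k) * pmf (galton_watson_mixture p j) m)"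
    by (rule member_le_sum) auto
  also have "\<dots> \<le> (1 + 2 * p) * pmf (galton_watson_mixture p j) (Suc k)"
    unfolding pmf_galton_watson_mixture[of j "Suc k"] using p by auto
  finally show ?case using p by (simp add: zero_less_mult_iff)
qed

section \<open>Comparison principle\<close>

text \<open>
  The sum at \<open>k\<close> involves only indices in \<open>[k/2, k]\<close>, so a bound on one dyadic
  block propagates; the diagonal term is absorbed because its weight is at most \<open>1 < L\<close>.
\<close>

lemma eventually_le_of_subsolution_supersolution:
  fixes u v :: "nat \<Rightarrow> real"
  assumes L: "1 < L"
    and u: "\<forall>\<^sub>F k in sequentially. L * u k \<le> (\<Sum>m\<le>k. pmf (offspring_sum p m) k * u m)"
    and v: "\<forall>\<^sub>F k in sequentially. (\<Sum>m\<le>k. pmf (offspring_sum p m) k * v m) \<le> L * v k"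
    and pos: "\<forall>\<^sub>F k in sequentially. 0 < v k"
  obtains C where "0 < C" "\<forall>\<^sub>F k in sequentially. u k \<le> C * v k"
proof -
  let ?b = "\<lambda>m k. pmf (offspring_sum p m) k"
  obtain N where N: "\<And>k. N \<le> k \<Longrightarrow> L * u k \<le> (\<Sum>m\<le>k. ?b m k * u m)"
    "\<And>k. N \<le> k \<Longrightarrow> (\<Sum>m\<le>k. ?b m k * v m) \<le> L * v k" "\<And>k. N \<le> k \<Longrightarrow> 0 < v k"
    using eventually_conj[OF u eventually_conj[OF v pos]] by (auto simp: eventually_sequentially)
  \<comment> \<open>The sum makes \<open>C\<close> dominate every ratio on the initial block
    \<open>[N, 2N)\<close>; the summand 1 makes it positive.\<close>
  define C where "C = 1 + (\<Sum>m\<in>{N..<2*N}. \<bar>u m\<bar> / v m)"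
  have C: "0 < C"
    unfolding C_def using N(3) by (intro add_pos_nonneg sum_nonneg divide_nonneg_pos) auto
  have "u k \<le> C * v k" if "N \<le> k" for k
    using that
  proof (induction k rule: less_induct)
    case (less k)
    show ?case
    proof (cases "k < 2 * N")
      case True
      have "\<bar>u k\<bar> / v k \<le> (\<Sum>m\<in>{N..<2*N}. \<bar>u m\<bar> / v m)"
        using True less.prems N(3) by (intro member_le_sum divide_nonneg_pos) auto
      then have "\<bar>u k\<bar> / v k \<le> C" by (simp add: C_def)
      then show ?thesis
        using N(3)[OF less.prems] by (simp add: field_simps)
    next
      case False
      have split: "(\<Sum>m\<le>k. ?b m k * f m) = ?b k k * f k + (\<Sum>m<k. ?b m k * f m)" for f :: "nat \<Rightarrow> real"
        by (simp add: lessThan_Suc_atMost[symmetric])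
      have "(\<Sum>m<k. ?b m k * u m) \<le> (\<Sum>m<k. ?b m k * (C * v m))"
      proof (rule sum_mono)
        fix m assume "m \<in> {..<k}"
        then show "?b m k * u m \<le> ?b m k * (C * v m)"
          using less.IH[of m] False pmf_offspring_sum_eq_0[of k m]
          by (cases "2 * m < k") (auto intro!: mult_left_mono)
      qed
      also have "\<dots> = C * (\<Sum>m<k. ?b m k * v m)"
        by (simp add: sum_distrib_left mult_ac)
      also have "\<dots> \<le> C * ((L - ?b k k) * v k)"
        using N(2)[OF less.prems] C unfolding split by (intro mult_left_mono) (auto simp: algebra_simps)
      finally have "(L - ?b k k) * u k \<le> (L - ?b k k) * (C * v k)"
        using N(1)[OF less.prems] unfolding split by (simp add: algebra_simps)
      moreover have "0 < L - ?b k k"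
        using L pmf_le_1[of "offspring_sum p k" k] by linarith
      ultimately show ?thesis by simp
    qed
  qed
  then show thesis
    using that[OF C] by (auto simp: eventually_sequentially)
qed

section \<open>Moments of the renewal weights\<close>

lemma sum_offspring_sum_Suc_Suc:
  fixes f :: "nat \<Rightarrow> real"
  shows "(\<Sum>m\<le>Suc (Suc k). pmf (offspring_sum p m) (Suc (Suc k)) * f m) =
    (1 - p) * (\<Sum>m\<le>Suc k. pmf (offspring_sum p m) (Suc k) * f (Suc m)) +
    p * (\<Sum>m\<le>k. pmf (offspring_sum p m) k * f (Suc m))"
proof -
  have "(\<Sum>m\<le>Suc (Suc k). pmf (offspring_sum p m) (Suc (Suc k)) * f m) =
      (\<Sum>m\<le>Suc k. pmf (offspring_sum p (Suc m)) (Suc (Suc k)) * f (Suc m))"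
    by (subst sum.atMost_Suc_shift) (simp add: pmf_offspring_sum_0)
  also have "\<dots> = (1 - p) * (\<Sum>m\<le>Suc k. pmf (offspring_sum p m) (Suc k) * f (Suc m)) +
      p * (\<Sum>m\<le>Suc k. pmf (offspring_sum p m) k * f (Suc m))"
    by (simp only: pmf_offspring_sum_Suc_Suc sum_distrib_left sum.distrib[symmetric])
       (simp add: algebra_simps)
  also have "(\<Sum>m\<le>Suc k. pmf (offspring_sum p m) k * f (Suc m)) =
      (\<Sum>m\<le>k. pmf (offspring_sum p m) k * f (Suc m))"
    by (simp add: pmf_offspring_sum_eq_0)
  finally show ?thesis .
qed

text \<open>Unnormalised moments in \<open>m\<close> at fixed \<open>k\<close>. As
  \<open>1 + p\<close> is the mean offspring number, the variable is centred near
  \<open>m = k/(1 + p)\<close>.\<close>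

definition moment :: "nat \<Rightarrow> nat \<Rightarrow> real" where
  "moment i k = (\<Sum>m\<le>k. pmf (offspring_sum p m) k * ((1 + p) * real m - real k) ^ i)"

lemma moment_at_0: "moment i 0 = (if i = 0 then 1 else 0)"
  by (simp add: moment_def pmf_offspring_sum_0)

lemma moment_at_1: "moment i (Suc 0) = (1 - p) * p ^ i"
  by (simp add: moment_def pmf_offspring_sum_0 pmf_offspring_sum_Suc_1)

lemma moment_0_Suc_Suc: "moment 0 (Suc (Suc k)) = (1 - p) * moment 0 (Suc k) + p * moment 0 k"
  unfolding moment_def power_0 by (rule sum_offspring_sum_Suc_Suc)

text \<open>Removing the first individual shifts the centred variable by \<open>p\<close> if it had
  one child and by \<open>- (1 - p)\<close> if it had two.\<close>

lemma moment_1_Suc_Suc: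
  "moment 1 (Suc (Suc k)) = (1 - p) * (moment 1 (Suc k) + p * moment 0 (Suc k)) +
    p * (moment 1 k - (1 - p) * moment 0 k)"
  unfolding moment_def power_0
  by (subst sum_offspring_sum_Suc_Suc)
     (simp add: sum_distrib_left sum.distrib[symmetric] sum_subtractf[symmetric] algebra_simps
       del: sum.atMost_Suc)

lemma moment_2_Suc_Suc:
  "moment 2 (Suc (Suc k)) =
    (1 - p) * (moment 2 (Suc k) + 2 * p * moment 1 (Suc k) + p\<^sup>2 * moment 0 (Suc k)) +
    p * (moment 2 k - 2 * (1 - p) * moment 1 k + (1 - p)\<^sup>2 * moment 0 k)"
  unfolding moment_def power_0
  by (subst sum_offspring_sum_Suc_Suc)
     (simp add: sum_distrib_left sum.distrib[symmetric] sum_subtractf[symmetric] algebra_simps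
       power2_eq_square del: sum.atMost_Suc)

text \<open>The recursion has characteristic roots 1 and \<open>- p\<close>, so the limit
  \<open>1/(1 + p)\<close> is approached geometrically.\<close>

lemma moment_0_eq: "moment 0 k = (1 - (- p) ^ Suc k) / (1 + p)"
proof -
  have "(1 + p) * moment 0 k = 1 - (- p) ^ Suc k"
  proof (induction k rule: induct_nat_012)
    case (ge2 n)
    have "(1 + p) * moment 0 (Suc (Suc n)) =
        (1 - p) * ((1 + p) * moment 0 (Suc n)) + p * ((1 + p) * moment 0 n)"
      unfolding moment_0_Suc_Suc by (simp add: algebra_simps)
    then show ?case
      unfolding ge2 by (simp add: algebra_simps)
  qed (simp_all add: moment_at_0 moment_at_1 algebra_simps)
  then show ?thesis
    using p by (simp add: field_simps)
qed

lemma moment_0_bounds: "0 \<le> moment 0 k" "moment 0 k \<le> 1"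
proof -
  have "\<bar>(- p) ^ Suc k\<bar> = p * p ^ k"
    using p by (simp add: power_abs abs_mult)
  moreover have "p * p ^ k \<le> p"
    using p by (simp add: mult_left_le power_le_one)
  ultimately have "\<bar>(- p) ^ Suc k\<bar> \<le> p" by simp
  then show "0 \<le> moment 0 k" "moment 0 k \<le> 1"
    unfolding moment_0_eq using p by (auto simp: field_simps abs_le_iff)
qed

text \<open>Dividing out the characteristic root 1 telescopes the second-order recursion: the
  difference of the two sides is constant in \<open>k\<close> and vanishes at 0.\<close>

lemma moment_1_Suc: "moment 1 (Suc k) = p * (1 - p) * moment 0 k - p * moment 1 k"
  by (induction k)
     (simp_all only: moment_1_Suc_Suc, simp_all add: moment_at_0 moment_at_1 algebra_simps)

lemma moment_1_bound: "\<bar>moment 1 k\<bar> \<le> p"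
proof (induction k)
  case (Suc k)
  have "\<bar>moment 1 (Suc k)\<bar> \<le> p * (1 - p) * moment 0 k + p * \<bar>moment 1 k\<bar>"
    unfolding moment_1_Suc using p moment_0_bounds[of k]
    by (intro abs_triangle_ineq4[THEN order_trans]) (simp add: abs_mult)
  also have "\<dots> \<le> p * (1 - p) * 1 + p * p"
    using p moment_0_bounds[of k] Suc by (intro add_mono mult_left_mono) auto
  finally show ?case by (simp add: algebra_simps)
qed (use p in \<open>simp add: moment_at_0\<close>)

text \<open>Each step is a convex combination of earlier values plus a bounded increment. Only
  linear growth matters; the constant 6 is generous.\<close>

lemma moment_2_bound: "moment 2 k \<le> 6 * real k"
proof (induction k rule: induct_nat_012)
  case 0
  show ?case by (simp add: moment_at_0)
next
  case 1
  have "(1 - p) * p\<^sup>2 \<le> 1 * 1"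
    using p by (intro mult_mono) (auto simp: power_le_one)
  then show ?case by (simp add: moment_at_1)
next
  case (ge2 n)
  have c: "0 \<le> 1 - p" "0 \<le> p" using p by auto
  have small: "p * \<bar>moment 1 i\<bar> \<le> 1 * 1" "(1 - p) * \<bar>moment 1 i\<bar> \<le> 1 * 1"
     "p\<^sup>2 * moment 0 i \<le> 1 * 1" "(1 - p)\<^sup>2 * moment 0 i \<le> 1 * 1" for i
    by (intro mult_mono; use p moment_0_bounds[of i] moment_1_bound[of i] in \<open>simp add: power_le_one\<close>)+
  have small': "\<bar>p * moment 1 i\<bar> \<le> 1" "\<bar>(1 - p) * moment 1 i\<bar> \<le> 1" for i
    using small(1,2)[of i] c by (simp_all add: abs_mult)
  have "2 * p * moment 1 (Suc n) \<le> 2"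
    using abs_le_D1[OF small'(1)[of "Suc n"]] by simp
  then have "moment 2 (Suc n) + 2 * p * moment 1 (Suc n) + p\<^sup>2 * moment 0 (Suc n) \<le> 6 * real (Suc n) + 6"
    using ge2 small(3)[of "Suc n"] by linarith
  moreover have "moment 2 n - 2 * (1 - p) * moment 1 n + (1 - p)\<^sup>2 * moment 0 n \<le> 6 * real (Suc n) + 6"
  proof -
    have "x - 2 * y + z \<le> 6 * real (Suc n) + 6" if "x \<le> 6 * real n" "- y \<le> 1" "z \<le> 1 * 1" for x y z :: real
      using that by simp
    from this[OF ge2(1) abs_le_D2[OF small'(2)] small(4)] show ?thesis
      by (simp only: mult.assoc)
  qed
  ultimately have "moment 2 (Suc (Suc n)) \<le>
      (1 - p) * (6 * real (Suc n) + 6) + p * (6 * real (Suc n) + 6)"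
    unfolding moment_2_Suc_Suc using c by (intro add_mono[OF mult_left_mono mult_left_mono])
  then show ?case by (simp add: algebra_simps)
qed

section \<open>Action of the operator on powers\<close>

lemma abs_powr_diff_le:
  fixes a l x y :: real
  assumes "0 < a" "0 < l" "l \<le> x" "l \<le> y"
  shows "\<bar>x powr - a - y powr - a\<bar> \<le> a * l powr (- a - 1) * \<bar>x - y\<bar>"
proof -
  have "norm (x powr - a - y powr - a) \<le> a * l powr (- a - 1) * norm (x - y)"
  proof (rule field_differentiable_bound[where S = "{l..}" and f' = "\<lambda>z. - a * z powr (- a - 1)"])
    fix z assume z: "z \<in> {l..}"
    then show "((\<lambda>z. z powr - a) has_field_derivative - a * z powr (- a - 1)) (at z within {l..})"
      using assms by (auto intro!: derivative_eq_intros)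
    show "norm (- a * z powr (- a - 1)) \<le> a * l powr (- a - 1)"
      using z assms by (simp add: abs_mult powr_mono2')
  qed (use assms in auto)
  then show ?thesis by simp
qed

text \<open>Replace \<open>m\<close> by the centre \<open>t = k/(1 + p)\<close>: the total mass
  \<open>moment 0 k\<close> then yields the factor, since \<open>t powr - a / (1 + p)\<close> equals
  \<open>(1 + p) powr (a - 1) * k powr - a\<close>.\<close>

lemma sum_offspring_sum_powr:
  assumes a: "0 < a"
  shows "(\<lambda>k. (\<Sum>m\<le>k. pmf (offspring_sum p m) k * real m powr - a) -
      (1 + p) powr (a - 1) * real k powr - a) \<in> O(\<lambda>k. real k powr (- a - 1 / 2))"
proof -
  let ?b = "\<lambda>m k. pmf (offspring_sum p m) k"
  let ?S = "\<lambda>k. \<Sum>m\<le>k. ?b m k * real m powr - a"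
  \<comment> \<open>The first summand pays for replacing \<open>m\<close> by \<open>t\<close>, the
    second for the geometric error in the total mass.\<close>
  let ?B = "\<lambda>k. a * (real k / 2) powr (- a - 1) * (7 / 2 * sqrt (real k)) +
    (1 + p) powr (a - 1) * real k powr - a * p ^ k"
  have "\<bar>?S k - (1 + p) powr (a - 1) * real k powr - a\<bar> \<le> ?B k" if k: "1 \<le> k" for k
  proof -
    define t where "t = real k / (1 + p)"
    define r where "r = sqrt (real k)"
    define K where "K = a * (real k / 2) powr (- a - 1)"
    let ?D = "\<lambda>m. (1 + p) * real m - real k"
    have r: "0 < r" "r\<^sup>2 = real k" and K: "0 < K"
      using k a by (auto simp: r_def K_def)
    have t: "real k / 2 \<le> t"
      unfolding t_def using p by (intro divide_left_mono) auto
    have term_le: "\<bar>?b m k * (real m powr - a - t powr - a)\<bar> \<le> ?b m k * (K * (r + ?D m ^ 2 / r) / 2)"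
      if "m \<le> k" for m
    \<comment> \<open>The vanishing case contains \<open>m = 0\<close>, where \<open>powr\<close>
      has the default value 0. Otherwise \<open>m\<close> and \<open>t\<close> are both at least
      \<open>k/2\<close>.\<close>
    proof (cases "2 * m < k")
      case True
      then show ?thesis by (simp add: pmf_offspring_sum_eq_0)
    next
      case False
      have "\<bar>real m powr - a - t powr - a\<bar> \<le> K * \<bar>real m - t\<bar>"
        unfolding K_def using False k a t by (intro abs_powr_diff_le) auto
      also have "\<dots> \<le> K * \<bar>?D m\<bar>"
      proof -
        have "\<bar>?D m\<bar> = (1 + p) * \<bar>real m - t\<bar>"
          using p by (simp add: t_def abs_mult[symmetric] field_simps)
        then show ?thesis
          using K p by (simp add: mult_le_cancel_right1)
      qed
      also have "\<dots> \<le> K * ((r + ?D m ^ 2 / r) / 2)"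
      proof -
        \<comment> \<open>The arithmetic-geometric mean inequality replaces the first absolute
          moment by the second; \<open>r = sqrt k\<close> balances the two terms.\<close>
        have "2 * r * \<bar>?D m\<bar> \<le> r ^ 2 + ?D m ^ 2"
          using zero_le_power2[of "r - \<bar>?D m\<bar>"] by (simp add: power2_diff)
        then show ?thesis
          using r(1) K by (intro mult_left_mono) (simp_all add: field_simps power2_eq_square)
      qed
      finally have "\<bar>real m powr - a - t powr - a\<bar> \<le> K * ((r + ?D m ^ 2 / r) / 2)" .
      from mult_left_mono[OF this pmf_nonneg[of "offspring_sum p m" k]] show ?thesis
        by (simp add: abs_mult)
    qed
    have "\<bar>?S k - t powr - a * moment 0 k\<bar> = \<bar>\<Sum>m\<le>k. ?b m k * (real m powr - a - t powr - a)\<bar>"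
      by (simp add: moment_def sum_distrib_left sum_subtractf[symmetric] algebra_simps)
    also have "\<dots> \<le> (\<Sum>m\<le>k. ?b m k * (K * (r + ?D m ^ 2 / r) / 2))"
      by (rule order_trans[OF sum_abs sum_mono]) (use term_le in auto)
    also have "\<dots> = K / 2 * (r * moment 0 k + moment 2 k / r)"
      by (simp add: moment_def sum_distrib_left sum_divide_distrib sum.distrib[symmetric] field_simps)
    also have "\<dots> \<le> K / 2 * (r * 1 + 6 * r\<^sup>2 / r)"
      using K r moment_0_bounds[of k] moment_2_bound[of k]
      by (intro mult_left_mono add_mono divide_right_mono) auto
    also have "\<dots> = K * (7 / 2 * r)"
      using r(1) by (simp add: power2_eq_square)
    finally have 1: "\<bar>?S k - t powr - a * moment 0 k\<bar> \<le> K * (7 / 2 * r)" .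
    have t_powr: "t powr - a = (1 + p) * ((1 + p) powr (a - 1) * real k powr - a)"
      using p k powr_mult_base[of "1 + p" "a - 1"]
      by (simp add: t_def powr_divide powr_minus flip: mult.assoc) (simp add: field_simps)
    have "t powr - a * moment 0 k - (1 + p) powr (a - 1) * real k powr - a =
        - ((1 + p) powr (a - 1) * real k powr - a * (- p) ^ Suc k)"
      unfolding t_powr moment_0_eq using p by (simp add: field_simps)
    then have "\<bar>t powr - a * moment 0 k - (1 + p) powr (a - 1) * real k powr - a\<bar> =
        (1 + p) powr (a - 1) * real k powr - a * p ^ Suc k"
      using p by (simp add: abs_mult power_abs)
    also have "\<dots> \<le> (1 + p) powr (a - 1) * real k powr - a * p ^ k"
      using p by (intro mult_left_mono) (auto simp: mult_left_le_one_le)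
    finally show ?thesis
      using 1 unfolding K_def r_def by linarith
  qed
  then have "(\<lambda>k. ?S k - (1 + p) powr (a - 1) * real k powr - a) \<in> O(?B)"
    by (intro bigoI[where c = 1] eventually_sequentiallyI[of 1])
       (unfold real_norm_def mult_1, rule order_trans[OF _ abs_ge_self])
  also have "?B \<in> O(\<lambda>k. real k powr (- a - 1 / 2))"
    using a p by real_asymp
  finally show ?thesis .
qed

section \<open>Corrected powers as sub- and supersolutions\<close>

text \<open>
  The power \<open>k powr - a\<close> solves the recursion only up to a relative error \<open>O(k powr (-1/2))\<close>;
  the correction of relative size \<open>k powr (-1/4)\<close> dominates this error and fixes its sign.
\<close>

lemma corrected_powr_subsolution_supersolution:
  fixes a s :: real
  assumes a: "0 < a" and s: "\<bar>s\<bar> = 1"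
  defines "w \<equiv> \<lambda>k. real k powr - a - s * real k powr - (a + 1 / 4)"
  shows "\<forall>\<^sub>F k in sequentially.
    s * (\<Sum>m\<le>k. pmf (offspring_sum p m) k * w m) \<le> s * ((1 + p) powr (a - 1) * w k)"
proof -
  define L where "L = (1 + p) powr (a - 1)"
  \<comment> \<open>The operator multiplies the correction by \<open>L * (1 + \<eta>)\<close> rather
    than \<open>L\<close>; this surplus has to beat the errors \<open>E\<close>.\<close>
  define \<eta> where "\<eta> = (1 + p) powr (1 / 4) - 1"
  define E where "E = (\<lambda>a k. (\<Sum>m\<le>k. pmf (offspring_sum p m) k * real m powr - a) -
      (1 + p) powr (a - 1) * real k powr - a)"
  have \<eta>: "0 < \<eta>" and L: "0 < L"
    using p by (auto simp: \<eta>_def L_def)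
  have "E a \<in> o(\<lambda>k. real k powr - (a + 1 / 4))"
    unfolding E_def by (rule landau_o.big_small_trans[OF sum_offspring_sum_powr[OF a]]) real_asymp
  moreover have "E (a + 1 / 4) \<in> o(\<lambda>k. real k powr - (a + 1 / 4))"
    unfolding E_def by (rule landau_o.big_small_trans[OF sum_offspring_sum_powr]) (use a in simp, real_asymp)
  ultimately have "(\<lambda>k. s * E a k - E (a + 1 / 4) k) \<in> o(\<lambda>k. real k powr - (a + 1 / 4))"
    using s by (intro sum_in_smallo) auto
  from landau_o.smallD[OF this mult_pos_pos[OF L \<eta>]]
  show ?thesis
  proof eventually_elim
    case (elim k)
    have "(1 + p) powr (a + 1 / 4 - 1) = L * (1 + \<eta>)"
      by (simp add: L_def \<eta>_def powr_add[symmetric])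
    then have sum_eq: "(\<Sum>m\<le>k. pmf (offspring_sum p m) k * w m) =
        (L * real k powr - a + E a k) - s * (L * (1 + \<eta>) * real k powr - (a + 1 / 4) + E (a + 1 / 4) k)"
      by (simp add: w_def E_def L_def right_diff_distrib sum_subtractf sum_distrib_left mult_ac)
    \<comment> \<open>Because \<open>s * s = 1\<close>, the surplus enters negatively for either
      sign: \<open>s = 1\<close> gives a supersolution and \<open>s = - 1\<close> a
      subsolution.\<close>
    have "s * (\<Sum>m\<le>k. pmf (offspring_sum p m) k * w m) - s * (L * w k) =
        s * E a k - (s * s) * E (a + 1 / 4) k - (s * s) * (L * \<eta> * real k powr - (a + 1 / 4))"
      unfolding sum_eq by (simp add: w_def algebra_simps)
    also have "s * s = 1"
      using s abs_mult_self_eq[of s] by simp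
    finally show ?case
      using elim by (simp add: L_def[symmetric])
  qed
qed

section \<open>Two-sided bounds for the law\<close>

lemma pmf_galton_watson_mixture_bounds:
  assumes j: "1 \<le> j" and \<rho>: "\<rho> = ln (1 + 2 * p) / ln (1 + p)"
  obtains c C where "0 < c" "0 < C" "\<forall>\<^sub>F k in sequentially.
    c * real k powr (- 1 - \<rho>) \<le> pmf (galton_watson_mixture p j) k \<and>
    pmf (galton_watson_mixture p j) k \<le> C * real k powr (- 1 - \<rho>)"
proof -
  let ?q = "pmf (galton_watson_mixture p j)"
  let ?w = "\<lambda>s k. real k powr - (1 + \<rho>) - s * real k powr - (1 + \<rho> + 1 / 4)"
  have \<rho>_pos: "0 < \<rho>" and L: "(1 + p) powr (1 + \<rho> - 1) = 1 + 2 * p"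
    using p by (auto simp: \<rho> powr_def)
  \<comment> \<open>Beyond \<open>j\<close> the source term is absent, so the law is at once a sub-
    and a supersolution.\<close>
  have q: "\<forall>\<^sub>F k in sequentially. (1 + 2 * p) * ?q k = (\<Sum>m\<le>k. pmf (offspring_sum p m) k * ?q m)"
    using eventually_gt_at_top[of j] by eventually_elim (simp add: pmf_galton_watson_mixture)
  have q_pos: "\<forall>\<^sub>F k in sequentially. 0 < ?q k"
    using eventually_ge_at_top[of j] by eventually_elim (rule pmf_galton_watson_mixture_pos[OF j])
  have w: "\<forall>\<^sub>F k in sequentially. s * (\<Sum>m\<le>k. pmf (offspring_sum p m) k * ?w s m) \<le>
      s * ((1 + 2 * p) * ?w s k)" if "\<bar>s\<bar> = 1" for s
    using corrected_powr_subsolution_supersolution[OF _ that, of "1 + \<rho>"] \<rho>_pos L by simp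
  have w_pos: "\<forall>\<^sub>F k in sequentially. 0 < ?w 1 k"
    by real_asymp
  have gt: "1 < 1 + 2 * p" using p by simp
  obtain C where C: "0 < C" "\<forall>\<^sub>F k in sequentially. ?q k \<le> C * ?w 1 k"
    by (rule eventually_le_of_subsolution_supersolution[OF gt, of ?q "?w 1"])
       (use q w[of 1] w_pos in \<open>auto elim: eventually_mono\<close>)
  \<comment> \<open>The roles are exchanged: the law is now the positive supersolution.\<close>
  obtain D where D: "0 < D" "\<forall>\<^sub>F k in sequentially. ?w (- 1) k \<le> D * ?q k"
    by (rule eventually_le_of_subsolution_supersolution[OF gt, of "?w (- 1)" ?q])
       (use q w[of "- 1"] q_pos in \<open>auto elim: eventually_mono\<close>)
  have "\<forall>\<^sub>F k in sequentially. 1 / D * real k powr (- 1 - \<rho>) \<le> ?q k \<and>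
      ?q k \<le> C * real k powr (- 1 - \<rho>)"
    using C(2) D(2)
  proof eventually_elim
    case (elim k)
    have "real k powr (- 1 - \<rho>) \<le> ?w (- 1) k"
      by simp
    also have "\<dots> \<le> D * ?q k" by fact
    finally have "1 / D * real k powr (- 1 - \<rho>) \<le> ?q k"
      using D(1) by (simp add: field_simps)
    moreover have "C * ?w 1 k \<le> C * real k powr (- 1 - \<rho>)"
      using C(1) by (intro mult_left_mono) auto
    ultimately show ?case using elim(1) by linarith
  qed
  with C(1) D(1) show thesis
    using that[of "1 / D" C] by simp
qed

end

theorem corollary2p2:
  fixes p \<rho> :: real
  assumes "0 < p" and "p < 1"
    and "\<rho> = ln (1 + 2 * p) / ln (1 + p)"
  shows "(\<forall>j\<ge>1.
            (\<exists>c C. 0 < c \<and> c \<le> C \<and>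
              (\<forall>\<^sub>F k in sequentially.
                 c * real k powr (- 1 - \<rho>) \<le> pmf (degree_law p j) k \<and>
                 pmf (degree_law p j) k \<le> C * real k powr (- 1 - \<rho>))) \<and>
            pmf (degree_law p j) \<in> \<Theta>(\<lambda>k. real k powr (- 1 - \<rho>))) \<and>
         pmf (homogeneous_network_degree_law p) \<in> \<Theta>(\<lambda>k. real k powr (- 1 - \<rho>)) \<and>
         pmf (treelike_network_degree_law p) \<in> \<Theta>(\<lambda>k. real k powr (- 1 - \<rho>))"
proof -
  let ?f = "\<lambda>k. real k powr (- 1 - \<rho>)"
  have main: "(\<exists>c C. 0 < c \<and> c \<le> C \<and> (\<forall>\<^sub>F k in sequentially.
        c * ?f k \<le> pmf (degree_law p j) k \<and> pmf (degree_law p j) k \<le> C * ?f k)) \<and>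
      pmf (degree_law p j) \<in> \<Theta>(?f)" if j: "1 \<le> j" for j
  proof -
    obtain c C where c: "0 < c" "0 < C" and ev: "\<forall>\<^sub>F k in sequentially.
        c * ?f k \<le> pmf (degree_law p j) k \<and> pmf (degree_law p j) k \<le> C * ?f k"
      using pmf_galton_watson_mixture_bounds[OF assms(1,2) j assms(3)]
      unfolding degree_law_eq_mixture[OF assms(1,2)] by blast
    \<comment> \<open>The two comparisons do not order their constants, hence
      \<open>max c C\<close>.\<close>
    have "\<forall>\<^sub>F k in sequentially. c * ?f k \<le> pmf (degree_law p j) k \<and>
        pmf (degree_law p j) k \<le> max c C * ?f k"
      using ev by eventually_elim (auto intro: order_trans[OF _ mult_right_mono])
    moreover have "pmf (degree_law p j) \<in> \<Theta>(?f)"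
      using ev c by (intro bigthetaI'[where ?c1.0 = c and ?c2.0 = C]) (auto elim: eventually_mono)
    ultimately show ?thesis
      using c(1) by (intro conjI exI[of _ c] exI[of _ "max c C"]) auto
  qed
  then show ?thesis
    unfolding homogeneous_network_degree_law_def treelike_network_degree_law_def by simp
qed

end
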